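(* Let $G$ be an undirected graph (multiple edges allowed) with vertex set $\{v_1,v_2,\ldots,v_n\}$. Label the basis element $x_i\otimes x_j=x_j\otimes x_i$ of $\operatorname{Sym}^2 V$ with the number of edges between $v_i$ and $v_j$ in $G$. Then $\operatorname{Aut}(G)$ is canonically isomorphic (via $v_i\leftrightarrow x_i$) to the subgroup of $S_n$ that preserves the labels on the basis elements of $\operatorname{Sym}^2 V$.
   Context: $X=\{x_1,\ldots,x_n\}$, $V$ is the $\mathbb{C}$-vector space with basis $X$, and $S_n$ acts on $V$ by permuting $X$: $\sigma x_i=x_{\sigma(i)}$. $\operatorname{Sym}^2V=V\otimes V/(x_i\otimes x_j-x_j\otimes x_i)$, with basis the classes of $x_i\otimes x_j$ for unordered pairs $\{i,j\}$ ($i=j$ allowed), on which $S_n$ acts by $\sigma(x_i\otimes x_j)=x_{\sigma(i)}\otimes x_{\sigma(j)}$. An element of $S_n$ preserves the labels if each basis element has the same label as its image. $\operatorname{Aut}(G)$ is the group of permutations of the vertex set that preserve the number of edges between every pair of vertices. *)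

theory Defs
  imports
    Complex_Main
    "HOL-Library.Function_Algebras"
    "HOL-Library.Set_Algebras"
    "HOL-Algebra.Sym_Groups"
begin

section \<open>The symmetric square of the permutation module\<close>

text \<open>
  Vectors are complex-valued coordinate functions. The space V with basis xvec 1, ..., xvec n
  consists of the functions on \<^typ>\<open>nat\<close> that vanish outside {1..n}; its tensor square consists of
  the functions on pairs that vanish outside {1..n} \<times> {1..n}, with xvec i \<otimes> xvec j as standard basis.
\<close>

definition scale_fun :: "complex \<Rightarrow> ('a \<Rightarrow> complex) \<Rightarrow> 'a \<Rightarrow> complex" (infixr \<open>*c\<close> 75)
  where "c *c u = (\<lambda>a. c * u a)"

global_interpretation fun_vs: vector_space scale_fun
  by standard (auto simp: scale_fun_def fun_eq_iff algebra_simps)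

lemma scale_fun_apply: "(c *c u) a = c * u a"
  by (simp add: scale_fun_def)

definition xvec :: "nat \<Rightarrow> nat \<Rightarrow> complex"
  where "xvec i = (\<lambda>k. if k = i then 1 else 0)"

definition Vspace :: "nat \<Rightarrow> (nat \<Rightarrow> complex) set"
  where "Vspace n = fun_vs.span (xvec ` {1..n})"

definition tensor :: "(nat \<Rightarrow> complex) \<Rightarrow> (nat \<Rightarrow> complex) \<Rightarrow> nat \<times> nat \<Rightarrow> complex"
    (infixl \<open>\<otimes>\<^sub>c\<close> 76)
  where "u \<otimes>\<^sub>c w = (\<lambda>(i, j). u i * w j)"

definition V_tensor_V :: "nat \<Rightarrow> (nat \<times> nat \<Rightarrow> complex) set"
  where "V_tensor_V n = fun_vs.span {u \<otimes>\<^sub>c w | u w. u \<in> Vspace n \<and> w \<in> Vspace n}"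

definition sym_relations :: "nat \<Rightarrow> (nat \<times> nat \<Rightarrow> complex) set"
  where "sym_relations n =
    fun_vs.span {xvec i \<otimes>\<^sub>c xvec j - xvec j \<otimes>\<^sub>c xvec i | i j. i \<in> {1..n} \<and> j \<in> {1..n}}"

text \<open>Elements of the quotient are cosets \<^term>\<open>t +o sym_relations n\<close>.\<close>

definition Sym2 :: "nat \<Rightarrow> (nat \<times> nat \<Rightarrow> complex) set set"
  where "Sym2 n = (\<lambda>t. t +o sym_relations n) ` V_tensor_V n"

definition sym2 :: "nat \<Rightarrow> nat \<Rightarrow> nat \<Rightarrow> (nat \<times> nat \<Rightarrow> complex) set"
  where "sym2 n i j = (xvec i \<otimes>\<^sub>c xvec j) +o sym_relations n"

definition Sym2_basis :: "nat \<Rightarrow> (nat \<times> nat \<Rightarrow> complex) set set"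
  where "Sym2_basis n = {sym2 n i j | i j. i \<in> {1..n} \<and> j \<in> {1..n}}"

text \<open>
  The actions on V and on its tensor square are the linear extensions of xvec i \<mapsto> xvec (\<sigma> i) and
  xvec i \<otimes> xvec j \<mapsto> \<sigma> (xvec i) \<otimes> \<sigma> (xvec j). The latter maps \<^term>\<open>sym_relations n\<close> onto itself, so the
  induced action on the quotient sends a coset to its image.
\<close>

definition act_V :: "nat \<Rightarrow> (nat \<Rightarrow> nat) \<Rightarrow> (nat \<Rightarrow> complex) \<Rightarrow> nat \<Rightarrow> complex"
  where "act_V n \<sigma> u = (\<Sum>i\<in>{1..n}. u i *c xvec (\<sigma> i))"

definition act_tensor ::
    "nat \<Rightarrow> (nat \<Rightarrow> nat) \<Rightarrow> (nat \<times> nat \<Rightarrow> complex) \<Rightarrow> nat \<times> nat \<Rightarrow> complex"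
  where "act_tensor n \<sigma> t =
    (\<Sum>i\<in>{1..n}. \<Sum>j\<in>{1..n}. t (i, j) *c (act_V n \<sigma> (xvec i) \<otimes>\<^sub>c act_V n \<sigma> (xvec j)))"

definition act_Sym2 ::
    "nat \<Rightarrow> (nat \<Rightarrow> nat) \<Rightarrow> (nat \<times> nat \<Rightarrow> complex) set \<Rightarrow> (nat \<times> nat \<Rightarrow> complex) set"
  where "act_Sym2 n \<sigma> B = act_tensor n \<sigma> ` B"

lemma x_in_V: "i \<in> {1..n} \<Longrightarrow> xvec i \<in> Vspace n"
  unfolding Vspace_def by (intro fun_vs.span_base imageI)

lemma Sym2_basis_subset: "Sym2_basis n \<subseteq> Sym2 n"
  unfolding Sym2_basis_def Sym2_def sym2_def V_tensor_V_def
  using x_in_V by (blast intro: fun_vs.span_base)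

lemma act_V_x:
  assumes "i \<in> {1..n}"
  shows "act_V n \<sigma> (xvec i) = xvec (\<sigma> i)"
proof -
  have "act_V n \<sigma> (xvec i) = (\<Sum>k\<in>{1..n}. if k = i then xvec (\<sigma> i) else 0)"
    unfolding act_V_def by (rule sum.cong) (auto simp: xvec_def scale_fun_def fun_eq_iff)
  then show ?thesis using assms by simp
qed

lemma act_tensor_x:
  assumes "i \<in> {1..n}" "j \<in> {1..n}"
  shows "act_tensor n \<sigma> (xvec i \<otimes>\<^sub>c xvec j) = xvec (\<sigma> i) \<otimes>\<^sub>c xvec (\<sigma> j)"
proof -
  have "act_tensor n \<sigma> (xvec i \<otimes>\<^sub>c xvec j) =
      (\<Sum>k\<in>{1..n}. \<Sum>l\<in>{1..n}. if l = j then (if k = i then xvec (\<sigma> i) \<otimes>\<^sub>c xvec (\<sigma> j) else 0) else 0)"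
    unfolding act_tensor_def
  proof (intro sum.cong refl)
    fix k l assume kl: "k \<in> {1..n}" "l \<in> {1..n}"
    have "(xvec i \<otimes>\<^sub>c xvec j) (k, l) = (if l = j then (if k = i then 1 else 0) else 0)"
      by (simp add: xvec_def tensor_def)
    then show "(xvec i \<otimes>\<^sub>c xvec j) (k, l) *c (act_V n \<sigma> (xvec k) \<otimes>\<^sub>c act_V n \<sigma> (xvec l)) =
        (if l = j then (if k = i then xvec (\<sigma> i) \<otimes>\<^sub>c xvec (\<sigma> j) else 0) else 0)"
      using kl by (auto simp: act_V_x)
  qed
  then show ?thesis using assms by simp
qed

lemma act_tensor_hom: "module_hom scale_fun scale_fun (act_tensor n \<sigma>)"
  by unfold_locales
    (simp_all add: act_tensor_def scale_fun_apply fun_vs.scale_left_distrib sum.distrib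
      fun_vs.scale_sum_right)

lemma act_tensor_relations:
  assumes "\<sigma> permutes {1..n}"
  shows "act_tensor n \<sigma> ` sym_relations n = sym_relations n"
proof -
  interpret module_hom scale_fun scale_fun "act_tensor n \<sigma>"
    by (rule act_tensor_hom)
  let ?R = "{xvec i \<otimes>\<^sub>c xvec j - xvec j \<otimes>\<^sub>c xvec i | i j. i \<in> {1..n} \<and> j \<in> {1..n}}"
  let ?r = "\<lambda>(i, j). xvec i \<otimes>\<^sub>c xvec j - xvec j \<otimes>\<^sub>c xvec i"
  have R: "?R = ?r ` ({1..n} \<times> {1..n})" by (auto simp: image_iff) (metis atLeastAtMost_iff One_nat_def)+
  have "act_tensor n \<sigma> ` ?R = (?r \<circ> map_prod \<sigma> \<sigma>) ` ({1..n} \<times> {1..n})"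
    unfolding R image_image by (intro image_cong refl) (auto simp: diff act_tensor_x)
  also have "\<dots> = ?R"
    unfolding R image_comp [symmetric] using permutes_image [OF assms]
    by (simp add: map_prod_surj_on)
  finally show ?thesis
    unfolding sym_relations_def using span_image [of ?R] by simp
qed

lemma act_Sym2_coset:
  assumes "\<sigma> permutes {1..n}"
  shows "act_Sym2 n \<sigma> (t +o sym_relations n) = act_tensor n \<sigma> t +o sym_relations n"
proof -
  interpret module_hom scale_fun scale_fun "act_tensor n \<sigma>"
    by (rule act_tensor_hom)
  have "act_Sym2 n \<sigma> (t +o sym_relations n) =
      act_tensor n \<sigma> t +o (act_tensor n \<sigma> ` sym_relations n)"
    unfolding act_Sym2_def elt_set_plus_def by (force simp: add image_iff)
  then show ?thesis by (simp add: act_tensor_relations [OF assms])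
qed

lemma act_Sym2_sym2:
  assumes "\<sigma> permutes {1..n}" "i \<in> {1..n}" "j \<in> {1..n}"
  shows "act_Sym2 n \<sigma> (sym2 n i j) = sym2 n (\<sigma> i) (\<sigma> j)"
  using assms by (simp add: sym2_def act_Sym2_coset act_tensor_x)

lemma sym_relations_antisym:
  assumes "t \<in> sym_relations n"
  shows "t (k, l) + t (l, k) = 0"
  using assms unfolding sym_relations_def
proof (induction rule: fun_vs.span_induct_alt)
  case base
  then show ?case by simp
next
  case (step c r t)
  then obtain i j where "r = xvec i \<otimes>\<^sub>c xvec j - xvec j \<otimes>\<^sub>c xvec i" by blast
  then have "r (k, l) + r (l, k) = 0" by (simp add: tensor_def)
  then have "c * (r (k, l) + r (l, k)) = 0" by simp
  then show ?case using step.IH by (simp add: scale_fun_def algebra_simps)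
qed

lemma sym2_eq_iff:
  assumes "i \<in> {1..n}" "j \<in> {1..n}"
  shows "sym2 n i j = sym2 n k l \<longleftrightarrow> {i, j} = {k, l}"
proof
  assume eq: "sym2 n i j = sym2 n k l"
  have "0 \<in> sym_relations n"
    unfolding sym_relations_def by (rule fun_vs.span_zero)
  then have "xvec i \<otimes>\<^sub>c xvec j \<in> sym2 n i j"
    by (force simp: sym2_def elt_set_plus_def)
  then obtain r where r: "r \<in> sym_relations n" "xvec i \<otimes>\<^sub>c xvec j = xvec k \<otimes>\<^sub>c xvec l + r"
    unfolding eq by (auto simp: sym2_def elt_set_plus_def)
  have "(xvec i \<otimes>\<^sub>c xvec j) (i, j) + (xvec i \<otimes>\<^sub>c xvec j) (j, i) =
      (xvec k \<otimes>\<^sub>c xvec l) (i, j) + (xvec k \<otimes>\<^sub>c xvec l) (j, i)"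
    unfolding r(2) using sym_relations_antisym [OF r(1), of i j] by (simp add: algebra_simps)
  then show "{i, j} = {k, l}"
    by (auto simp: xvec_def tensor_def split: if_splits)
next
  assume "{i, j} = {k, l}"
  then consider "k = i" "l = j" | "k = j" "l = i" by (auto simp: doubleton_eq_iff)
  then show "sym2 n i j = sym2 n k l"
  proof cases
    case 2
    have r: "xvec i \<otimes>\<^sub>c xvec j - xvec j \<otimes>\<^sub>c xvec i \<in> sym_relations n"
      unfolding sym_relations_def by (rule fun_vs.span_base) (use assms in blast)
    have "xvec i \<otimes>\<^sub>c xvec j \<in> (xvec j \<otimes>\<^sub>c xvec i) +o sym_relations n"
      unfolding elt_set_plus_def using r by (force simp: algebra_simps)
    moreover have "a +o sym_relations n = b +o sym_relations n"
      if "a \<in> b +o sym_relations n" for a b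
    proof -
      obtain s where s: "s \<in> sym_relations n" "a = b + s"
        using \<open>a \<in> b +o sym_relations n\<close> by (auto simp: elt_set_plus_def)
      have add: "s + u \<in> sym_relations n" "u - s \<in> sym_relations n"
        if "u \<in> sym_relations n" for u
        using that s(1) unfolding sym_relations_def
        by (auto intro: fun_vs.span_add fun_vs.span_diff)
      show ?thesis
      proof (rule Set.set_eqI)
        fix c
        have "c \<in> a +o sym_relations n \<longleftrightarrow> c - b - s \<in> sym_relations n"
          by (force simp: s(2) elt_set_plus_def algebra_simps intro: bexI [of _ "c - b - s"])
        also have "\<dots> \<longleftrightarrow> c - b \<in> sym_relations n"
          using add(1) [of "c - b - s"] add(2) [of "c - b"] by (auto simp: algebra_simps)
        also have "\<dots> \<longleftrightarrow> c \<in> b +o sym_relations n"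
          by (force simp: elt_set_plus_def algebra_simps intro: bexI [of _ "c - b"])
        finally show "c \<in> a +o sym_relations n \<longleftrightarrow> c \<in> b +o sym_relations n" .
      qed
    qed
    ultimately show ?thesis
      unfolding sym2_def 2 by blast
  qed simp
qed


section \<open>Undirected multigraphs\<close>

text \<open>
  The field \<^term>\<open>ends\<close> gives the set of end points of an edge, a singleton for a loop.
\<close>

record ('v, 'e) multigraph =
  verts :: "'v set"
  edges :: "'e set"
  ends :: "'e \<Rightarrow> 'v set"

definition undirected_multigraph :: "('v, 'e) multigraph \<Rightarrow> bool"
  where "undirected_multigraph G \<longleftrightarrow> finite (verts G) \<and> finite (edges G) \<and>
    (\<forall>e\<in>edges G. \<exists>u\<in>verts G. \<exists>w\<in>verts G. ends G e = {u, w})"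

definition num_edges :: "('v, 'e) multigraph \<Rightarrow> 'v \<Rightarrow> 'v \<Rightarrow> nat"
  where "num_edges G u w = card {e \<in> edges G. ends G e = {u, w}}"

definition Aut :: "('v, 'e) multigraph \<Rightarrow> ('v \<Rightarrow> 'v) monoid"
  where "Aut G =
    \<lparr>carrier = {\<pi>. \<pi> permutes verts G \<and>
        (\<forall>u\<in>verts G. \<forall>w\<in>verts G. num_edges G (\<pi> u) (\<pi> w) = num_edges G u w)},
      mult = (\<circ>), one = id\<rparr>"

lemma group_Aut: "group (Aut G)"
proof (rule groupI)
  fix \<pi> assume \<pi>: "\<pi> \<in> carrier (Aut G)"
  then have p: "\<pi> permutes verts G" by (simp add: Aut_def)
  note q = permutes_inv [OF p] permutes_inverses [OF p]
  have "num_edges G (inv' \<pi> u) (inv' \<pi> w) = num_edges G u w"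
    if "u \<in> verts G" "w \<in> verts G" for u w
  proof -
    have "inv' \<pi> u \<in> verts G" "inv' \<pi> w \<in> verts G"
      using that permutes_in_image [OF q(1)] by auto
    then have "num_edges G (\<pi> (inv' \<pi> u)) (\<pi> (inv' \<pi> w)) = num_edges G (inv' \<pi> u) (inv' \<pi> w)"
      using \<pi> by (simp add: Aut_def)
    then show ?thesis by (simp add: q)
  qed
  then show "\<exists>\<rho>\<in>carrier (Aut G). \<rho> \<otimes>\<^bsub>Aut G\<^esub> \<pi> = \<one>\<^bsub>Aut G\<^esub>"
    using q(1) permutes_inv_o(2) [OF p]
    by (intro bexI [of _ "inv' \<pi>"]) (auto simp: Aut_def)
qed (auto simp: Aut_def permutes_compose permutes_id permutes_in_image comp_assoc)


section \<open>Labels\<close>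

text \<open>
  The label of sym2 n i j is the number of edges between v i and v j; the lemma below shows that this
  does not depend on the choice of representatives.
\<close>

definition edge_label ::
    "('v, 'e) multigraph \<Rightarrow> (nat \<Rightarrow> 'v) \<Rightarrow> nat \<Rightarrow> (nat \<times> nat \<Rightarrow> complex) set \<Rightarrow> nat"
  where "edge_label G v n b =
    (THE m. \<exists>i\<in>{1..n}. \<exists>j\<in>{1..n}. b = sym2 n i j \<and> m = num_edges G (v i) (v j))"

lemma edge_label_sym2:
  assumes "i \<in> {1..n}" "j \<in> {1..n}"
  shows "edge_label G v n (sym2 n i j) = num_edges G (v i) (v j)"
  unfolding edge_label_def
proof (rule the_equality)
  fix m assume "\<exists>k\<in>{1..n}. \<exists>l\<in>{1..n}. sym2 n i j = sym2 n k l \<and> m = num_edges G (v k) (v l)"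
  then obtain k l where m: "m = num_edges G (v k) (v l)" and "{i, j} = {k, l}"
    using sym2_eq_iff [OF assms] by blast
  then have "{v k, v l} = {v i, v j}" by (auto simp: doubleton_eq_iff)
  then show "m = num_edges G (v i) (v j)" by (simp add: m num_edges_def)
qed (use assms in blast)

definition label_preserving ::
    "nat \<Rightarrow> ((nat \<times> nat \<Rightarrow> complex) set \<Rightarrow> nat) \<Rightarrow> (nat \<Rightarrow> nat) set"
  where "label_preserving n label =
    {\<sigma> \<in> carrier (sym_group n). \<forall>b\<in>Sym2_basis n. label (act_Sym2 n \<sigma> b) = label b}"

end

theory Submission
  imports Defs
begin

text \<open>
  Conjugation by v embeds \<^term>\<open>Aut G\<close> into the symmetric group. Its image is exactly the set of
  label-preserving permutations, which is therefore a subgroup because it is the image of a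
  homomorphism.
\<close>

lemma xvec_eq_iff [simp]: "xvec i = xvec j \<longleftrightarrow> i = j"
  by (auto simp: xvec_def fun_eq_iff split: if_splits)

text \<open>Every element of \<open>Sym2_basis n\<close> is some \<open>sym2 n i j\<close>, which
  \<sigma> sends to \<open>sym2 n (\<sigma> i) (\<sigma> j)\<close>. This removes the symmetric
  square from the argument: what is left is the condition defining \<open>Aut G\<close>, read
  through the numbering \<open>v\<close>.\<close>

lemma label_preserving_edge_label:
  "\<sigma> \<in> label_preserving n (edge_label G v n) \<longleftrightarrow> \<sigma> permutes {1..n} \<and>
    (\<forall>i\<in>{1..n}. \<forall>j\<in>{1..n}. num_edges G (v (\<sigma> i)) (v (\<sigma> j)) = num_edges G (v i) (v j))"
proof (cases "\<sigma> permutes {1..n}")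
  case True
  have "(\<forall>b\<in>Sym2_basis n. P b) \<longleftrightarrow> (\<forall>i\<in>{1..n}. \<forall>j\<in>{1..n}. P (sym2 n i j))" for P
    unfolding Sym2_basis_def by blast
  moreover have "edge_label G v n (act_Sym2 n \<sigma> (sym2 n i j)) = num_edges G (v (\<sigma> i)) (v (\<sigma> j))"
    if "i \<in> {1..n}" "j \<in> {1..n}" for i j
    unfolding act_Sym2_sym2 [OF True that]
    by (rule edge_label_sym2) (use that permutes_in_image [OF True] in blast)+
  ultimately show ?thesis
    using True by (simp add: label_preserving_def sym_group_carrier edge_label_sym2)
qed (simp add: label_preserving_def sym_group_carrier)

text \<open>Transporting \<open>q\<close> back along the inverse of \<open>f\<close> gives a
  preimage, since the round trip is the identity on permutations of \<open>B\<close>.\<close>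

lemma map_permutation_permutes_image:
  assumes "bij_betw f A B"
  shows "map_permutation A f ` {p. p permutes A} = {q. q permutes B}"
proof (intro equalityI subsetI)
  fix q assume "q \<in> {q. q permutes B}"
  then have q: "q permutes B" by simp
  show "q \<in> map_permutation A f ` {p. p permutes A}"
  proof
    show "q = map_permutation A f (map_permutation B (inv_into A f) q)"
      using map_permutation_compose_inv [OF bij_betw_inv_into [OF assms] q, of f]
        bij_betw_inv_into_right [OF assms] by simp
    show "map_permutation B (inv_into A f) q \<in> {p. p permutes A}"
      using map_permutation_permutes [OF bij_betw_inv_into [OF assms] q] by simp
  qed
qed (use map_permutation_permutes [OF assms] in blast)

text \<open>Transport along \<open>inv_into A f\<close> is a left inverse.\<close>

lemma inj_on_map_permutation:
  assumes "bij_betw f A B"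
  shows "inj_on (map_permutation A f) {p. p permutes A}"
  using map_permutation_compose_inv [OF assms] bij_betw_inv_into_left [OF assms]
  by (metis (mono_tags, lifting) inj_onI mem_Collect_eq)

theorem proposition6p2:
  fixes G :: "('v, 'e) multigraph" and v :: "nat \<Rightarrow> 'v" and n :: nat
  assumes "undirected_multigraph G"
    and "bij_betw v {1..n} (verts G)"
  shows "subgroup (label_preserving n (edge_label G v n)) (sym_group n) \<and>
    (\<exists>\<phi> \<in> iso (Aut G) ((sym_group n)\<lparr>carrier := label_preserving n (edge_label G v n)\<rparr>).
      \<forall>\<pi>\<in>carrier (Aut G). \<forall>i\<in>{1..n}. \<forall>k\<in>{1..n}.
        \<pi> (v i) = v k \<longleftrightarrow> act_V n (\<phi> \<pi>) (xvec i) = xvec k)"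
proof -
  \<comment> \<open>\<open>w\<close> numbers the vertices, so \<open>\<phi> \<pi>\<close> is
    \<open>w \<circ> \<pi> \<circ> v\<close> on \<open>{1..n}\<close> and the identity
    elsewhere.\<close>
  define w where "w = inv_into {1..n} v"
  define \<phi> where "\<phi> = map_permutation (verts G) w"
  let ?L = "label_preserving n (edge_label G v n)"
  have verts: "verts G = v ` {1..n}"
    using assms(2) by (simp add: bij_betw_def)
  have w: "bij_betw w (verts G) {1..n}"
    unfolding w_def by (rule bij_betw_inv_into [OF assms(2)])
  have \<phi>_permutes: "\<phi> \<pi> permutes {1..n}" if "\<pi> permutes verts G" for \<pi>
    unfolding \<phi>_def using w that by (rule map_permutation_permutes)
  \<comment> \<open>The numbering \<open>v\<close> intertwines \<open>\<phi> \<pi>\<close> with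
    \<pi>. Both the label condition and the compatibility with
    \<open>v i \<leftrightarrow> xvec i\<close> are read off from this equation.\<close>
  have v_\<phi>: "v (\<phi> \<pi> i) = \<pi> (v i)" if "\<pi> permutes verts G" "i \<in> {1..n}" for \<pi> i
  proof -
    have vi: "v i \<in> verts G" "w (v i) = i"
      using that(2) bij_betw_inv_into_left [OF assms(2)] by (auto simp: verts w_def)
    then have "\<phi> \<pi> i = w (\<pi> (v i))"
      using map_permutation_apply [OF bij_betw_imp_inj_on [OF w] vi(1), of \<pi>]
      by (simp add: \<phi>_def)
    then show ?thesis
      using bij_betw_inv_into_right [OF assms(2)] permutes_in_image [OF that(1)] vi(1)
      by (simp add: w_def)
  qed
  \<comment> \<open>The direction from left to right gives surjectivity below: a label-preserving
    \<sigma> is \<open>\<phi> \<pi>\<close> for some permutation \<pi> of the vertices, and \<pi> is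
    then an automorphism.\<close>
  have \<phi>_label: "\<phi> \<pi> \<in> ?L \<longleftrightarrow> \<pi> \<in> carrier (Aut G)" if "\<pi> permutes verts G" for \<pi>
    using that \<phi>_permutes [OF that] v_\<phi> [OF that]
    by (simp add: label_preserving_edge_label Aut_def verts)
  have image: "\<phi> ` carrier (Aut G) = ?L"
  proof
    show "\<phi> ` carrier (Aut G) \<subseteq> ?L"
      using \<phi>_label by (auto simp: Aut_def)
    show "?L \<subseteq> \<phi> ` carrier (Aut G)"
    proof
      fix \<sigma> assume \<sigma>: "\<sigma> \<in> ?L"
      then have "\<sigma> \<in> \<phi> ` {\<pi>. \<pi> permutes verts G}"
        by (simp add: label_preserving_edge_label \<phi>_def map_permutation_permutes_image [OF w])
      then show "\<sigma> \<in> \<phi> ` carrier (Aut G)"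
        using \<sigma> \<phi>_label by blast
    qed
  qed
  have inj: "inj_on \<phi> (carrier (Aut G))"
    unfolding \<phi>_def
    by (rule inj_on_subset [OF inj_on_map_permutation [OF w]]) (auto simp: Aut_def)
  \<comment> \<open>As \<rho> maps \<open>verts G\<close> to itself, the inner \<open>v\<close> and
    \<open>w\<close> cancel in the composite of the two conjugates.\<close>
  have mult: "\<phi> (\<pi> \<otimes>\<^bsub>Aut G\<^esub> \<rho>) = \<phi> \<pi> \<circ> \<phi> \<rho>" if "\<rho> \<in> carrier (Aut G)" for \<pi> \<rho>
    using that map_permutation_compose' [OF bij_betw_imp_inj_on [OF w]]
    by (simp add: Aut_def \<phi>_def)
  interpret group_hom "Aut G" "sym_group n" \<phi>
  proof (intro group_hom.intro group_hom_axioms.intro group_Aut sym_group_is_group homI)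
    show "\<phi> \<pi> \<in> carrier (sym_group n)" if "\<pi> \<in> carrier (Aut G)" for \<pi>
      using that \<phi>_permutes by (simp add: Aut_def sym_group_carrier)
  qed (simp add: mult sym_group_mult)
  have "subgroup ?L (sym_group n)"
    using img_is_subgroup by (simp add: image)
  moreover have "\<phi> \<in> iso (Aut G) ((sym_group n)\<lparr>carrier := ?L\<rparr>)"
    by (intro isoI homI) (use image inj mult in \<open>auto simp: bij_betw_def sym_group_mult\<close>)
  \<comment> \<open>Both sides say \<open>\<phi> \<pi> i = k\<close>: the left one because
    \<open>v\<close> is injective on \<open>{1..n}\<close>, the right one because distinct indices
    give distinct basis vectors.\<close>
  moreover have "\<pi> (v i) = v k \<longleftrightarrow> act_V n (\<phi> \<pi>) (xvec i) = xvec k"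
    if "\<pi> \<in> carrier (Aut G)" "i \<in> {1..n}" "k \<in> {1..n}" for \<pi> i k
  proof -
    have \<pi>: "\<pi> permutes verts G"
      using that(1) by (simp add: Aut_def)
    have "\<phi> \<pi> i \<in> {1..n}"
      using permutes_in_image [OF \<phi>_permutes [OF \<pi>]] that(2) by blast
    then show ?thesis
      using that(2,3) bij_betw_imp_inj_on [OF assms(2)]
      by (simp add: act_V_x inj_on_eq_iff flip: v_\<phi> [OF \<pi> that(2)])
  qed
  ultimately show ?thesis by blast
qed

end
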